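(* Let $R$ be a Dedekind domain and let $I$ be a nonzero ideal of $R$ such that $R/I$ is finite and nontrivial. If $I$ is a prime ideal, then $d(G_{R/I})=1$. If $I$ is not a prime ideal and $I$ has no prime ideal divisor $P$ with $|R/P|=2$, then $d(G_{R/I})=2$.
   Context: $G_{R/I}$ is the unitary Cayley graph of $R/I$: vertex set $R/I$, with $a+I$, $b+I$ adjacent iff $a-b+I$ is a unit of $R/I$. $d$ denotes the diameter. *)

theory Defs
  imports "HOL-Algebra.Algebra" "Graph_Theory.Shortest_Path"
begin

section \<open>Dedekind domains\<close>

text \<open>A fraction \<open>a / b\<close> is integral over \<open>R\<close> if it is a root of a monic polynomial
  \<open>X^n + \<Sum>i<n. c\<^sub>i X^i\<close> over \<open>R\<close>. Multiplying by \<open>b^n\<close> turns this into the equation below,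
  and \<open>a / b\<close> lies in \<open>R\<close> iff \<open>b\<close> divides \<open>a\<close>; thus the field of fractions need not be
  constructed.\<close>

definition integrally_closed :: "('a, 'b) ring_scheme \<Rightarrow> bool" where
  "integrally_closed R \<longleftrightarrow>
    (\<forall>a \<in> carrier R. \<forall>b \<in> carrier R - {\<zero>\<^bsub>R\<^esub>}. \<forall>n. \<forall>c \<in> {..<n} \<rightarrow> carrier R.
       a [^]\<^bsub>R\<^esub> (n::nat) \<oplus>\<^bsub>R\<^esub>
         (\<Oplus>\<^bsub>R\<^esub>i\<in>{..<n}. c i \<otimes>\<^bsub>R\<^esub> a [^]\<^bsub>R\<^esub> i \<otimes>\<^bsub>R\<^esub> b [^]\<^bsub>R\<^esub> (n - i)) = \<zero>\<^bsub>R\<^esub>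
       \<longrightarrow> b divides\<^bsub>R\<^esub> a)"

text \<open>Fields are admitted (Krull dimension at most one).\<close>

locale dedekind_domain = noetherian_domain +
  assumes integrally_closed: "integrally_closed R"
    and nonzero_prime_maximal: "\<lbrakk> primeideal P R; P \<noteq> {\<zero>} \<rbrakk> \<Longrightarrow> maximalideal P R"


section \<open>Unitary Cayley graphs and diameter\<close>

text \<open>As usual in \<^theory>\<open>Graph_Theory.Digraph\<close>, an undirected edge is a pair of opposite arcs.\<close>

definition unitary_Cayley_graph :: "('a, 'b) ring_scheme \<Rightarrow> ('a, 'a \<times> 'a) pre_digraph" where
  "unitary_Cayley_graph A =
    \<lparr> verts = carrier A,
      arcs = {(x, y). x \<in> carrier A \<and> y \<in> carrier A \<and> x \<ominus>\<^bsub>A\<^esub> y \<in> Units A},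
      tail = fst, head = snd \<rparr>"

text \<open>With unit weights, \<^const>\<open>wf_digraph.\<mu>\<close> is the usual graph distance (infinite between
  different components).\<close>

definition graph_diameter :: "('v, 'e) pre_digraph \<Rightarrow> ereal" where
  "graph_diameter G = (SUP u\<in>verts G. SUP v\<in>verts G. wf_digraph.\<mu> G (\<lambda>_. 1) u v)"

lemma (in cring) graph_unitary_Cayley_graph:
  assumes fin: "finite (carrier R)" and nontriv: "carrier R \<noteq> {\<zero>}"
  shows "graph (unitary_Cayley_graph R)"
proof -
  let ?G = "unitary_Cayley_graph R"
  have "\<zero> \<notin> Units R"
  proof
    assume "\<zero> \<in> Units R"
    then have "\<one> = \<zero>"
      using Units_r_inv[of \<zero>] l_null[OF Units_inv_closed[of \<zero>]] by simp
    then show False using nontriv one_zeroD by blast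
  qed
  then have noloop: "x \<ominus> x \<notin> Units R" if "x \<in> carrier R" for x
    using that by (simp add: a_minus_def r_neg)
  have sym: "y \<ominus> x \<in> Units R" if "x \<in> carrier R" "y \<in> carrier R" "x \<ominus> y \<in> Units R" for x y
  proof -
    have "\<ominus> \<one> \<in> Units R"
      by (auto simp: Units_def l_minus intro!: bexI[of _ "\<ominus> \<one>"])
    then have "(\<ominus> \<one>) \<otimes> (x \<ominus> y) \<in> Units R"
      using that(3) by (rule Units_m_closed)
    moreover have "(\<ominus> \<one>) \<otimes> (x \<ominus> y) = y \<ominus> x"
      using that(1,2) by (simp add: a_minus_def l_minus minus_add a_comm)
    ultimately show ?thesis by simp
  qed
  have "finite (arcs ?G)"
    by (rule finite_subset[of _ "carrier R \<times> carrier R"])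
      (use fin in \<open>auto simp: unitary_Cayley_graph_def\<close>)
  moreover have "symmetric ?G"
    unfolding symmetric_conv by (auto simp: unitary_Cayley_graph_def intro: sym)
  ultimately show ?thesis
    by unfold_locales
      (use fin noloop in \<open>auto simp: unitary_Cayley_graph_def arc_to_ends_def\<close>)
qed

end

theory Submission
  imports Defs
begin

text \<open>If \<open>I\<close> is prime, \<open>R / I\<close> is a field and the graph is complete. Otherwise \<open>R / I\<close> is not a field,
  and a nonzero nonunit is at distance at least two from \<open>0\<close>. For the upper bound it suffices that
  every element of \<open>R / I\<close> is a sum of two units, i.e. that for every \<open>z\<close> there is a \<open>w\<close> with \<open>w\<close> and
  \<open>z - w\<close> outside each of the finitely many maximal ideals \<open>M \<supseteq> I\<close>. Modulo one \<open>M\<close> this excludes at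
  most two residues and there are more than two; the maximal ideals are treated one after the other,
  correcting \<open>w\<close> by a multiple of an element outside \<open>M\<close> but inside all ideals already treated.
  The hypothesis on residue fields applies to every \<open>M \<supseteq> I\<close> because containing means dividing for
  ideals of a Dedekind domain.\<close>

section \<open>Noetherian domains\<close>

text \<open>Zorn's lemma applies because a nonempty chain of ideals in a noetherian ring contains
  its own union, which is therefore an upper bound inside \<open>S\<close>.\<close>

lemma (in noetherian_ring) maximal_member_of_ideals:
  assumes "S \<subseteq> {J. ideal J R}" and "S \<noteq> {}"
  obtains M where "M \<in> S" and "\<And>J. \<lbrakk>J \<in> S; M \<subseteq> J\<rbrakk> \<Longrightarrow> J = M"
proof -
  have "\<exists>M\<in>S. \<forall>J\<in>S. M \<subseteq> J \<longrightarrow> J = M"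
  proof (rule subset_Zorn)
    fix C assume C: "subset.chain S C"
    show "\<exists>U\<in>S. \<forall>J\<in>C. J \<subseteq> U"
    proof (cases "C = {}")
      case True
      with assms(2) show ?thesis by auto
    next
      case False
      have "subset.chain {J. ideal J R} C"
        using C assms(1) unfolding pred_on.chain_def by (meson subset_trans)
      then have "\<Union>C \<in> C"
        using ideal_chain_is_trivial False by blast
      then have "\<Union>C \<in> S"
        using C unfolding pred_on.chain_def by auto
      then show ?thesis by (intro bexI[of _ "\<Union>C"]) auto
    qed
  qed
  with that show thesis by blast
qed

lemma (in noetherian_ring) exists_maximalideal:
  assumes "ideal A R" and "A \<noteq> carrier R"
  obtains M where "maximalideal M R" and "A \<subseteq> M"
proof -
  let ?S = "{J. ideal J R \<and> A \<subseteq> J \<and> J \<noteq> carrier R}"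
  obtain M where M: "M \<in> ?S" and max: "\<And>J. \<lbrakk>J \<in> ?S; M \<subseteq> J\<rbrakk> \<Longrightarrow> J = M"
  proof (rule maximal_member_of_ideals[of ?S])
    show "?S \<noteq> {}" using assms by auto
  qed auto
  have "maximalideal M R"
  proof (rule maximalidealI)
    fix J assume J: "ideal J R" "M \<subseteq> J" "J \<subseteq> carrier R"
    show "J = M \<or> J = carrier R"
    proof (cases "J = carrier R")
      case False
      then have "J \<in> ?S" using J M by auto
      then show ?thesis using max J(2) by simp
    qed simp
  qed (use M in auto)
  moreover have "A \<subseteq> M" using M by simp
  ultimately show thesis using that by simp
qed

lemma (in cring) ideal_colon_element:
  assumes "ideal A R" and "x \<in> carrier R"
  shows "ideal {r \<in> carrier R. x \<otimes> r \<in> A} R"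
  using ideal.helper_max_prime[OF assms(1) is_cring assms(2)] .

text \<open>Thus \<open>P\<close> is an associated prime of \<open>A\<close>. For \<open>s \<notin> A\<close>, a witness for the colon ideal \<open>(A : s)\<close>
  times \<open>s\<close> is a witness for \<open>A\<close>. In an ideal \<open>A\<close> maximal without witness, \<open>xy \<in> A\<close> with
  \<open>x, y \<notin> A\<close>; then \<open>s = x\<close> or any \<open>s \<in> (A : x) - P\<close> has \<open>A \<subset> (A : s) \<subseteq> P\<close>.\<close>

lemma (in noetherian_domain) prime_colon_witness:
  assumes dim1: "\<And>Q. \<lbrakk>primeideal Q R; Q \<noteq> {\<zero>}\<rbrakk> \<Longrightarrow> maximalideal Q R"
    and A: "ideal A R" "A \<noteq> {\<zero>}" and P: "primeideal P R" and AP: "A \<subseteq> P"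
  obtains b where "b \<in> carrier R" and "b \<notin> A" and "\<And>p. p \<in> P \<Longrightarrow> b \<otimes> p \<in> A"
proof -
  interpret P: primeideal P R by (rule P)
  let ?bad = "\<lambda>A. \<forall>b\<in>carrier R - A. \<exists>p\<in>P. b \<otimes> p \<notin> A"
  let ?S = "{A. ideal A R \<and> A \<noteq> {\<zero>} \<and> A \<subseteq> P \<and> ?bad A}"
  have "?S = {}"
  proof (rule ccontr)
    assume "?S \<noteq> {}"
    then obtain B where B: "B \<in> ?S" and max: "\<And>J. \<lbrakk>J \<in> ?S; B \<subseteq> J\<rbrakk> \<Longrightarrow> J = B"
      using maximal_member_of_ideals[of ?S] by blast
    interpret B: ideal B R using B by blast
    have no_colon: False
      if s: "s \<in> carrier R" and x: "x \<in> carrier R" "x \<notin> B" "s \<otimes> x \<in> B"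
        and sub: "{r \<in> carrier R. s \<otimes> r \<in> B} \<subseteq> P" for s x
    proof -
      let ?J = "{r \<in> carrier R. s \<otimes> r \<in> B}"
      have J: "ideal ?J R" using ideal_colon_element[OF B.is_ideal s] .
      have BJ: "B \<subseteq> ?J" using s B.I_l_closed B.Icarr by blast
      moreover have "\<zero> \<in> B" by simp
      ultimately have "?J \<noteq> {\<zero>}" using B by blast
      have "?J \<noteq> B" using x by blast
      then have "?J \<notin> ?S" using max BJ by blast
      with J \<open>?J \<noteq> {\<zero>}\<close> sub obtain b where b: "b \<in> carrier R" "b \<notin> ?J"
        and bP: "\<And>p. p \<in> P \<Longrightarrow> b \<otimes> p \<in> ?J" by blast
      have "s \<otimes> b \<in> carrier R - B" using b s by blast
      then obtain p where p: "p \<in> P" "(s \<otimes> b) \<otimes> p \<notin> B" using B by blast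
      moreover have "s \<otimes> (b \<otimes> p) \<in> B" using bP[OF p(1)] by blast
      ultimately show False
        using m_assoc[OF s b(1) P.Icarr[OF p(1)]] by simp
    qed
    show False
    proof (cases "primeideal B R")
      case True
      \<comment> \<open>A prime \<open>B\<close> is maximal, hence equal to \<open>P\<close>, and
        then \<open>\<one>\<close> is a witness for \<open>B\<close>.\<close>
      then have "maximalideal B R" using dim1 B by blast
      then have "P = B"
        using maximalideal.I_maximal P.is_ideal P.a_subset P.I_notcarr B by blast
      moreover have "\<one> \<notin> P" using P.one_imp_carrier P.I_notcarr by blast
      ultimately show False using B P.Icarr by force
    next
      case False
      have "carrier R \<noteq> B" using B P.a_subset P.I_notcarr by blast
      then obtain x y where x: "x \<in> carrier R" "x \<notin> B" and y: "y \<in> carrier R" "y \<notin> B"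
        and xy: "x \<otimes> y \<in> B"
        using B.primeidealCD[OF is_cring False] by blast
      show False
      proof (cases "{r \<in> carrier R. x \<otimes> r \<in> B} \<subseteq> P")
        case True
        show False using no_colon[OF x(1) y xy True] .
      next
        case False
        then obtain s where s: "s \<in> carrier R" "x \<otimes> s \<in> B" "s \<notin> P" by blast
        \<comment> \<open>If \<open>s r\<close> lies in \<open>B\<close>, it lies in
          \<open>P\<close>, and \<open>s\<close> does not, so \<open>r\<close> does. Here
          \<open>x\<close> shows that the colon ideal of \<open>s\<close> is larger than
          \<open>B\<close>.\<close>
        have "{r \<in> carrier R. s \<otimes> r \<in> B} \<subseteq> P"
          using P.I_prime s B by blast
        moreover have "s \<otimes> x \<in> B" using s x m_comm by simp
        ultimately show False using no_colon[OF s(1) x] by blast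
      qed
    qed
  qed
  with A AP have "\<not> ?bad A" by blast
  with that show thesis by blast
qed

text \<open>Adding one generator at a time, the generated ideal stays inside the sum of the previous
  one and a principal ideal. The coefficients indexed by \<open>{..<n}\<close> have the shape that
  \<open>integrally_closed\<close> expects.\<close>

lemma (in cring) genideal_image_lessThan:
  fixes x :: "nat \<Rightarrow> 'a"
  assumes x: "\<And>i. x i \<in> carrier R" and "y \<in> Idl (x ` {..<n})"
  shows "\<exists>c\<in>{..<n} \<rightarrow> carrier R. y = (\<Oplus>i\<in>{..<n}. c i \<otimes> x i)"
  using assms(2)
proof (induction n arbitrary: y)
  case 0
  have "Idl {} \<subseteq> {\<zero>}" by (rule genideal_minimal) (auto simp: zeroideal)
  with 0 show ?case by auto
next
  case (Suc n)
  have xn: "x ` {..<n} \<subseteq> carrier R" using x by blast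
  have "Idl (x ` {..<Suc n}) \<subseteq> Idl (x ` {..<n}) <+> PIdl (x n)"
  proof (rule genideal_minimal)
    show id: "ideal (Idl (x ` {..<n}) <+> PIdl (x n)) R"
      by (intro add_ideals genideal_ideal cgenideal_ideal xn x)
    have "Idl (x ` {..<n}) <+> PIdl (x n) = Idl (Idl (x ` {..<n}) \<union> PIdl (x n))"
      by (rule union_genideal[symmetric]) (intro genideal_ideal cgenideal_ideal xn x)+
    moreover have "Idl (x ` {..<n}) \<union> PIdl (x n) \<subseteq> Idl (Idl (x ` {..<n}) \<union> PIdl (x n))"
      using genideal_ideal[OF xn] cgenideal_ideal[OF x[of n]]
      by (intro genideal_self) (auto dest: ideal.Icarr)
    ultimately show "x ` {..<Suc n} \<subseteq> Idl (x ` {..<n}) <+> PIdl (x n)"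
      using genideal_self[OF xn] cgenideal_self[OF x[of n]] by (auto simp: lessThan_Suc)
  qed
  with Suc.prems obtain u v where u: "u \<in> Idl (x ` {..<n})" and v: "v \<in> PIdl (x n)"
    and y: "y = u \<oplus> v" by (auto simp: set_add_def')
  obtain c where c: "c \<in> {..<n} \<rightarrow> carrier R" and uc: "u = (\<Oplus>i\<in>{..<n}. c i \<otimes> x i)"
    using Suc.IH[OF u] by blast
  obtain r where r: "r \<in> carrier R" "v = r \<otimes> x n" using v by (auto simp: cgenideal_def)
  let ?c = "c(n := r)"
  have "(\<Oplus>i\<in>{..<Suc n}. ?c i \<otimes> x i) = r \<otimes> x n \<oplus> (\<Oplus>i\<in>{..<n}. ?c i \<otimes> x i)"
    using c r x by (simp add: lessThan_Suc finsum_insert Pi_def)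
  also have "(\<Oplus>i\<in>{..<n}. ?c i \<otimes> x i) = u"
    unfolding uc using c x by (intro finsum_cong') (auto simp: Pi_def)
  also have "r \<otimes> x n \<oplus> u = y"
    using y r x c uc by (simp add: a_comm finsum_closed Pi_def)
  finally show ?case
    using c r by (intro bexI[of _ ?c]) (auto simp: Pi_def)
qed

text \<open>Among the ideals generated by initial segments of the sequence, a maximal one already
  contains the next term.\<close>

lemma (in noetherian_ring) genideal_sequence_stationary:
  fixes x :: "nat \<Rightarrow> 'a"
  assumes x: "\<And>i. x i \<in> carrier R"
  obtains n where "x n \<in> Idl (x ` {..<n})"
proof -
  let ?J = "\<lambda>n. Idl (x ` {..<n})"
  have sub: "x ` {..<n} \<subseteq> carrier R" for n using x by blast
  obtain M where M: "M \<in> range ?J" and max: "\<And>J. \<lbrakk>J \<in> range ?J; M \<subseteq> J\<rbrakk> \<Longrightarrow> J = M"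
    using maximal_member_of_ideals[of "range ?J"] genideal_ideal[OF sub] by blast
  obtain n where n: "M = ?J n" using M by blast
  have "?J n \<subseteq> ?J (Suc n)"
    by (rule genideal_minimal[OF genideal_ideal[OF sub]])
       (use genideal_self[OF sub, of "Suc n"] in auto)
  then have "?J (Suc n) = ?J n" using max n by blast
  moreover have "x n \<in> ?J (Suc n)" using genideal_self[OF sub, of "Suc n"] by auto
  ultimately show thesis using that by simp
qed

text \<open>The hypothesis says that multiplication by \<open>b / a\<close> maps the nonzero ideal \<open>P\<close> to itself. For
  \<open>0 \<noteq> p \<in> P\<close> the elements \<open>x\<^sub>n = (b / a)\<^sup>n p\<close> generate a finitely generated ideal, so some \<open>x\<^sub>n\<close>
  is a linear combination of its predecessors; cancelling \<open>p\<close> shows that \<open>b / a\<close> is integral.\<close>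

lemma (in noetherian_domain) divides_if_stabilises_ideal:
  assumes ic: "integrally_closed R"
    and P: "ideal P R" "P \<noteq> {\<zero>}"
    and a: "a \<in> carrier R" "a \<noteq> \<zero>" and b: "b \<in> carrier R"
    and stab: "\<And>p. p \<in> P \<Longrightarrow> \<exists>q\<in>P. b \<otimes> p = a \<otimes> q"
  shows "a divides b"
proof -
  interpret P: ideal P R by (rule P)
  obtain p where p: "p \<in> P" "p \<noteq> \<zero>" using P P.zero_closed by blast
  \<comment> \<open>\<open>f\<close> is multiplication by \<open>b / a\<close> on \<open>P\<close>,
    expressed without fractions.\<close>
  obtain f where f: "\<And>q. q \<in> P \<Longrightarrow> f q \<in> P \<and> b \<otimes> q = a \<otimes> f q"
    using stab by metis
  define x where "x n = (f ^^ n) p" for n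
  have xP: "x n \<in> P" for n by (induction n) (use f p in \<open>auto simp: x_def\<close>)
  then have xR: "x n \<in> carrier R" for n using P.Icarr by blast
  have pR: "p \<in> carrier R" using p P.Icarr by blast
  have x0: "x 0 = p" and xS: "a \<otimes> x (Suc n) = b \<otimes> x n" for n
    using f[OF xP[of n]] by (auto simp: x_def)
  have pow: "a [^] n \<otimes> x n = b [^] n \<otimes> p" for n
  proof (induction n)
    case 0
    show ?case using pR by (simp add: x0)
  next
    case (Suc n)
    have "a [^] Suc n \<otimes> x (Suc n) = a [^] n \<otimes> (a \<otimes> x (Suc n))"
      using a xR by (simp add: m_assoc)
    also have "\<dots> = b \<otimes> (a [^] n \<otimes> x n)"
      unfolding xS using a b xR by (simp add: m_lcomm)
    also have "\<dots> = b [^] Suc n \<otimes> p"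
      unfolding Suc.IH using b pR by (simp add: m_assoc m_lcomm)
    finally show ?case .
  qed
  obtain n where n: "x n \<in> Idl (x ` {..<n})"
    using genideal_sequence_stationary[of x] xR by blast
  obtain c where c: "c \<in> {..<n} \<rightarrow> carrier R" and xc: "x n = (\<Oplus>i\<in>{..<n}. c i \<otimes> x i)"
    using genideal_image_lessThan[OF xR n] by blast
  let ?s = "\<Oplus>i\<in>{..<n}. c i \<otimes> b [^] i \<otimes> a [^] (n - i)"
  have cR: "i < n \<Longrightarrow> c i \<in> carrier R" for i using c by auto
  have sR: "?s \<in> carrier R" using a b cR by (intro finsum_closed) auto
  \<comment> \<open>Multiply the relation for \<open>x n\<close> by \<open>a [^] n\<close> and
    replace each \<open>a [^] i \<otimes> x i\<close> by \<open>b [^] i \<otimes> p\<close>; then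
    \<open>p\<close> cancels.\<close>
  have "b [^] n \<otimes> p = a [^] n \<otimes> x n" by (simp add: pow)
  also have "\<dots> = (\<Oplus>i\<in>{..<n}. a [^] n \<otimes> (c i \<otimes> x i))"
    unfolding xc using a cR xR by (intro finsum_rdistr) auto
  also have "\<dots> = (\<Oplus>i\<in>{..<n}. (c i \<otimes> b [^] i \<otimes> a [^] (n - i)) \<otimes> p)"
  proof (rule finsum_cong')
    fix i assume "i \<in> {..<n}"
    then have i: "i < n" by simp
    have "a [^] n = a [^] (n - i) \<otimes> a [^] i"
      using i a by (simp add: nat_pow_mult)
    then have "a [^] n \<otimes> (c i \<otimes> x i) = c i \<otimes> a [^] (n - i) \<otimes> (a [^] i \<otimes> x i)"
      using a cR[OF i] xR[of i] by (simp add: m_ac)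
    also have "\<dots> = (c i \<otimes> b [^] i \<otimes> a [^] (n - i)) \<otimes> p"
      unfolding pow using a b cR[OF i] pR by (simp add: m_ac)
    finally show "a [^] n \<otimes> (c i \<otimes> x i) = (c i \<otimes> b [^] i \<otimes> a [^] (n - i)) \<otimes> p" .
  qed (use a b cR pR in auto)
  also have "\<dots> = ?s \<otimes> p"
    using a b cR pR by (intro finsum_ldistr[symmetric]) auto
  finally have bs: "b [^] n = ?s"
    using m_rcancel[OF p(2) pR _ sR] b by simp
  \<comment> \<open>The definition has all terms on one side, hence the negated coefficients. Its
    numerator comes first, so it is instantiated below with \<open>b\<close> before
    \<open>a\<close>.\<close>
  have "(\<Oplus>i\<in>{..<n}. (\<ominus> c i) \<otimes> b [^] i \<otimes> a [^] (n - i))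
      = (\<Oplus>i\<in>{..<n}. (\<ominus> \<one>) \<otimes> (c i \<otimes> b [^] i \<otimes> a [^] (n - i)))"
    using a b cR by (intro finsum_cong') (auto simp: l_minus)
  also have "\<dots> = (\<ominus> \<one>) \<otimes> ?s"
    using a b cR by (intro finsum_rdistr[symmetric]) auto
  finally have "b [^] n \<oplus> (\<Oplus>i\<in>{..<n}. (\<ominus> c i) \<otimes> b [^] i \<otimes> a [^] (n - i)) = \<zero>"
    using sR by (simp add: bs l_minus r_neg)
  moreover have "(\<lambda>i. \<ominus> c i) \<in> {..<n} \<rightarrow> carrier R" using cR by auto
  ultimately show "a divides b"
    using ic[unfolded integrally_closed_def, rule_format, of b a "\<lambda>i. \<ominus> c i" n] a b by simp
qed


section \<open>Divisibility of ideals in Dedekind domains\<close>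

text \<open>By maximality \<open>I\<close> and \<open>e\<close> together generate the whole ring.
  This is the invertibility of \<open>e\<close> modulo \<open>I\<close> in terms of elements of
  \<open>R\<close>.\<close>

lemma (in maximalideal) obtain_combination:
  assumes "cring R" and e: "e \<in> carrier R" "e \<notin> I" and z: "z \<in> carrier R"
  obtains r k where "r \<in> carrier R" and "k \<in> I" and "z = k \<oplus> r \<otimes> e"
proof -
  interpret cring R by fact
  have J: "ideal (I <+> PIdl e) R" by (intro add_ideals is_ideal cgenideal_ideal e)
  have "I \<subseteq> I <+> PIdl e" and "PIdl e \<subseteq> I <+> PIdl e"
    using genideal_self[of "I \<union> PIdl e"] a_subset ideal.Icarr[OF cgenideal_ideal[OF e(1)]]
    unfolding union_genideal[OF is_ideal cgenideal_ideal[OF e(1)]] by auto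
  then have "I <+> PIdl e = carrier R"
    using I_maximal[OF J _ additive_subgroup.a_subset[OF ideal.axioms(1)[OF J]]]
      cgenideal_self[OF e(1)] e(2) by blast
  then have "z \<in> I <+> PIdl e" using z by simp
  then obtain k v where "k \<in> I" "v \<in> PIdl e" "z = k \<oplus> v"
    by (auto simp: set_add_def')
  with that show thesis by (auto simp: cgenideal_def)
qed

text \<open>With \<open>0 \<noteq> a \<in> P\<close> and \<open>b \<notin> (a)\<close>, \<open>b P \<subseteq> (a)\<close>, the fraction \<open>b / a\<close> lies in the inverse of \<open>P\<close> and,
  not being integral over \<open>R\<close>, does not map \<open>P\<close> into itself. So \<open>1 = k + q\<close> with \<open>q \<in> P\<close> and
  \<open>k \<in> (b / a) P\<close>, and the cofactor of \<open>P\<close> in \<open>I\<close> is the colon ideal \<open>(I : P)\<close>.\<close>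

lemma (in dedekind_domain) prime_divides_if_contains:
  assumes I: "ideal I R" "I \<noteq> {\<zero>}" and P: "primeideal P R" and IP: "I \<subseteq> P"
  shows "P divides\<^bsub>ideals_set R\<^esub> I"
proof -
  interpret P: primeideal P R by (rule P)
  interpret I: ideal I R by (rule I)
  obtain a where a: "a \<in> I" "a \<noteq> \<zero>" using I I.zero_closed by blast
  then have aR: "a \<in> carrier R" and aP: "a \<in> P" using IP I.Icarr by auto
  have Pmax: "maximalideal P R" using nonzero_prime_maximal[OF P] a aP by blast
  have "PIdl a \<noteq> {\<zero>}" using cgenideal_self[OF aR] a by blast
  then obtain b where b: "b \<in> carrier R" "b \<notin> PIdl a" and bP: "\<And>p. p \<in> P \<Longrightarrow> b \<otimes> p \<in> PIdl a"
    using prime_colon_witness[OF nonzero_prime_maximal cgenideal_ideal[OF aR] _ P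
        cgenideal_minimal[OF P.is_ideal aP]] by blast
  have quot: "\<exists>z\<in>carrier R. b \<otimes> p = a \<otimes> z" if "p \<in> P" for p
    using bP[OF that] aR by (auto simp: cgenideal_def m_comm)
  have "\<not> a divides b"
    using b aR by (auto simp: factor_def cgenideal_def m_comm)
  then obtain p where p: "p \<in> P" and np: "\<And>q. q \<in> P \<Longrightarrow> b \<otimes> p \<noteq> a \<otimes> q"
    using divides_if_stabilises_ideal[OF integrally_closed P.is_ideal _ aR a(2) b(1)] a aP by blast
  \<comment> \<open>\<open>e\<close> is \<open>(b / a) p\<close>, an element of \<open>R\<close>
    outside \<open>P\<close>.\<close>
  obtain e where e: "e \<in> carrier R" "b \<otimes> p = a \<otimes> e" using quot[OF p] by blast
  then have "e \<notin> P" using np by blast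
  then obtain r q where r: "r \<in> carrier R" and q: "q \<in> P" and one: "\<one> = q \<oplus> r \<otimes> e"
    using maximalideal.obtain_combination[OF Pmax is_cring e(1) _ one_closed] by metis
  have pR: "p \<in> carrier R" and qR: "q \<in> carrier R" using p q P.Icarr by auto
  let ?J = "{z \<in> carrier R. \<forall>p\<in>P. p \<otimes> z \<in> I}"
  have J: "ideal ?J R"
  proof -
    \<comment> \<open>\<open>p\<close> shows that the family is nonempty; an empty intersection
      would be the whole type.\<close>
    have "?J = \<Inter> ((\<lambda>p. {z \<in> carrier R. p \<otimes> z \<in> I}) ` P)"
      using p by blast
    moreover have "ideal (\<Inter> ((\<lambda>p. {z \<in> carrier R. p \<otimes> z \<in> I}) ` P)) R"
      using p P.Icarr ideal_colon_element[OF I(1)] by (intro i_Intersect) auto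
    ultimately show ?thesis by simp
  qed
  have "I = P \<cdot> ?J"
  proof
    show "P \<cdot> ?J \<subseteq> I"
    proof
      fix x assume "x \<in> P \<cdot> ?J"
      then show "x \<in> I" by induction auto
    qed
    show "I \<subseteq> P \<cdot> ?J"
    proof
      fix y assume y: "y \<in> I"
      then have yR: "y \<in> carrier R" using I.Icarr by blast
      \<comment> \<open>\<open>z\<close> is \<open>(b / a) y\<close>. For \<open>w\<close> in
        \<open>P\<close>, \<open>v = (b / a) w\<close> lies in \<open>R\<close> and
        \<open>w z = v y\<close> lies in \<open>I\<close>, so \<open>z\<close> lies in
        \<open>?J\<close>. Since \<open>y e = p z\<close>, multiplying \<open>1 = q + r e\<close> by
        \<open>y\<close> gives \<open>y = q y + (r p) z\<close>, a sum of two products from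
        \<open>P\<close> and \<open>?J\<close>.\<close>
      obtain z where z: "z \<in> carrier R" "b \<otimes> y = a \<otimes> z" using quot y IP by blast
      have "a \<otimes> (y \<otimes> e) = y \<otimes> (b \<otimes> p)" unfolding e(2) using aR yR e(1) by (simp add: m_lcomm)
      also have "\<dots> = (b \<otimes> y) \<otimes> p" using b yR pR by (simp add: m_ac)
      also have "\<dots> = a \<otimes> (p \<otimes> z)" unfolding z(2) using aR z(1) pR by (simp add: m_ac)
      finally have ye: "y \<otimes> e = p \<otimes> z"
        using m_lcancel[OF a(2) aR] yR e(1) pR z(1) by simp
      have "w \<otimes> z \<in> I" if w: "w \<in> P" for w
      proof -
        have wR: "w \<in> carrier R" using w P.Icarr by blast
        obtain v where v: "v \<in> carrier R" "b \<otimes> w = a \<otimes> v" using quot[OF w] by blast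
        have "a \<otimes> (w \<otimes> z) = w \<otimes> (b \<otimes> y)" unfolding z(2) using aR wR z(1) by (simp add: m_lcomm)
        also have "\<dots> = (b \<otimes> w) \<otimes> y" using b wR yR by (simp add: m_ac)
        also have "\<dots> = a \<otimes> (v \<otimes> y)" unfolding v(2) using aR v(1) yR by (simp add: m_ac)
        finally have "w \<otimes> z = v \<otimes> y"
          using m_lcancel[OF a(2) aR] wR z(1) v(1) yR by simp
        with I.I_l_closed[OF y v(1)] show ?thesis by simp
      qed
      then have zJ: "z \<in> ?J" using z by blast
      have yJ: "y \<in> ?J" using y yR P.Icarr I.I_l_closed by blast
      have "y = y \<otimes> (q \<oplus> r \<otimes> e)" using yR by (simp flip: one)
      also have "\<dots> = q \<otimes> y \<oplus> r \<otimes> (y \<otimes> e)"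
        using yR qR r e(1) by (simp add: r_distr m_ac)
      also have "\<dots> = q \<otimes> y \<oplus> (r \<otimes> p) \<otimes> z"
        unfolding ye using r pR z(1) by (simp add: m_assoc)
      finally have "y = q \<otimes> y \<oplus> (r \<otimes> p) \<otimes> z" .
      moreover have "q \<otimes> y \<oplus> (r \<otimes> p) \<otimes> z \<in> P \<cdot> ?J"
        using q yJ zJ P.I_l_closed[OF p r] by (blast intro: ideal_prod.intros)
      ultimately show "y \<in> P \<cdot> ?J" by simp
    qed
  qed
  with J show ?thesis
    unfolding factor_def by (auto simp: ideals_set_def)
qed

section \<open>Sums of two units in finite quotients\<close>

text \<open>Otherwise every residue modulo \<open>M\<close> is that of \<open>\<zero>\<close> or of
  \<open>z\<close>, and \<open>\<one>\<close> differs from \<open>\<zero>\<close>, so there are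
  exactly two. An infinite quotient is covered as well, its \<open>card\<close> being 0.\<close>

lemma (in cring) obtain_two_nonmembers:
  assumes M: "maximalideal M R" and card: "card (carrier (R Quot M)) \<noteq> 2" and z: "z \<in> carrier R"
  obtains c where "c \<in> carrier R" and "c \<notin> M" and "z \<ominus> c \<notin> M"
proof (rule ccontr)
  assume "\<not> thesis"
  with that have all: "c \<in> M \<or> z \<ominus> c \<in> M" if "c \<in> carrier R" for c
    using \<open>c \<in> carrier R\<close> by blast
  interpret M: maximalideal M R by (rule M)
  have one: "\<one> \<notin> M" using M.one_imp_carrier M.I_notcarr by blast
  have coset: "M +> c = M +> d \<longleftrightarrow> c \<ominus> d \<in> M" if "c \<in> carrier R" "d \<in> carrier R" for c d
    using quotient_eq_iff_same_a_r_cos[OF M.is_ideal that] by blast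
  have "M +> c \<in> {M +> \<zero>, M +> z}" if "c \<in> carrier R" for c
    using all[OF that] coset[OF that zero_closed] coset[OF z that] that
    by (auto simp: a_minus_def)
  then have "carrier (R Quot M) \<subseteq> {M +> \<zero>, M +> z}"
    by (auto simp: FactRing_simps)
  moreover have "M +> \<one> \<in> carrier (R Quot M)" "M +> \<zero> \<in> carrier (R Quot M)"
    by (auto simp: FactRing_simps)
  moreover have "M +> \<one> \<noteq> M +> \<zero>"
    using coset[OF one_closed zero_closed] one by (simp add: a_minus_def)
  ultimately have "carrier (R Quot M) = {M +> \<one>, M +> \<zero>}" by blast
  with card \<open>M +> \<one> \<noteq> M +> \<zero>\<close> show False by simp
qed

text \<open>Distinct maximal ideals are incomparable, so each \<open>N\<close> in \<open>F\<close>
  has an element outside \<open>M\<close>; the product of these elements stays outside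
  \<open>M\<close> because \<open>M\<close> is prime.\<close>

lemma (in cring) maximalideals_avoidance:
  assumes "finite F" and "\<And>N. N \<in> F \<Longrightarrow> maximalideal N R"
    and "maximalideal M R" and "M \<notin> F"
  shows "\<exists>e\<in>carrier R - M. \<forall>N\<in>F. e \<in> N"
  using assms(1,2,4)
proof (induction F)
  case empty
  interpret M: maximalideal M R by fact
  show ?case using M.one_imp_carrier M.I_notcarr by blast
next
  case (insert N F)
  interpret M: maximalideal M R by fact
  interpret N: maximalideal N R using insert by blast
  obtain e where e: "e \<in> carrier R - M" "\<forall>N\<in>F. e \<in> N" using insert by auto
  have "\<not> N \<subseteq> M"
    using N.I_maximal[OF M.is_ideal _ M.a_subset] M.I_notcarr insert.prems by blast
  then obtain t where t: "t \<in> N" "t \<notin> M" by blast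
  then have tR: "t \<in> carrier R" using N.Icarr by blast
  have "t \<otimes> e \<notin> M"
    using primeideal.I_prime[OF maximalideal_prime[OF M.is_maximalideal] tR, of e] t e by blast
  moreover have "t \<otimes> e \<in> N" using N.I_r_closed t e by blast
  moreover have "t \<otimes> e \<in> N'" if "N' \<in> F" for N'
    using ideal.I_l_closed[OF maximalideal.axioms(1)[OF insert.prems(1)], of N' e t] that e tR by blast
  ultimately show ?case using tR e by (intro bexI[of _ "t \<otimes> e"]) auto
qed

lemma (in cring) obtain_common_two_nonmembers:
  assumes "finite F"
    and "\<And>M. M \<in> F \<Longrightarrow> maximalideal M R \<and> card (carrier (R Quot M)) \<noteq> 2"
    and z: "z \<in> carrier R"
  shows "\<exists>w\<in>carrier R. \<forall>M\<in>F. w \<notin> M \<and> z \<ominus> w \<notin> M"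
  using assms(1,2)
proof (induction F)
  case empty
  show ?case by blast
next
  case (insert M F)
  interpret M: maximalideal M R using insert by blast
  obtain w where w: "w \<in> carrier R" "\<forall>N\<in>F. w \<notin> N \<and> z \<ominus> w \<notin> N" using insert by auto
  obtain e where e: "e \<in> carrier R" "e \<notin> M" "\<forall>N\<in>F. e \<in> N"
    using maximalideals_avoidance[of F M] insert by blast
  obtain c where c: "c \<in> carrier R" "c \<notin> M" "z \<ominus> c \<notin> M"
    using obtain_two_nonmembers[OF M.is_maximalideal _ z] insert.prems by blast
  \<comment> \<open>With this \<open>r\<close>, the element \<open>w + r e\<close> is congruent to
    \<open>c\<close> modulo \<open>M\<close>, and still to \<open>w\<close> modulo every ideal in
    \<open>F\<close>, since these contain \<open>e\<close>.\<close>
  obtain r k where r: "r \<in> carrier R" and k: "k \<in> M" and cw: "c \<ominus> w = k \<oplus> r \<otimes> e"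
    using M.obtain_combination[OF is_cring e(1,2), of "c \<ominus> w"] c w by blast
  let ?w = "w \<oplus> r \<otimes> e"
  have kR: "k \<in> carrier R" using k M.Icarr by blast
  have shift: "x \<in> N \<longleftrightarrow> y \<in> N"
    if "ideal N R" "h \<in> N" "x \<in> carrier R" "y \<in> carrier R" "x = y \<oplus> h" for N h x y
  proof -
    interpret N: ideal N R by fact
    have hR: "h \<in> carrier R" using that N.Icarr by blast
    have "y = x \<oplus> \<ominus> h" using that hR by (simp add: a_assoc r_neg)
    with that show ?thesis using N.a_closed N.a_inv_closed by metis
  qed
  have "c = w \<oplus> (c \<ominus> w)" using c w by (simp add: a_minus_def a_lcomm r_neg)
  then have cw': "c = ?w \<oplus> k" using cw kR r e w by (simp add: a_ac)
  then have zc: "z \<ominus> ?w = (z \<ominus> c) \<oplus> k"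
    using kR r e w z by (simp add: a_minus_def minus_add a_assoc l_neg)
  have "?w \<notin> M"
    using shift[OF M.is_ideal k c(1) _ cw'] c r e w by simp
  moreover have "z \<ominus> ?w \<notin> M"
    using shift[OF M.is_ideal k _ _ zc] c r e w z by simp
  moreover have "?w \<notin> N \<and> z \<ominus> ?w \<notin> N" if N: "N \<in> F" for N
  proof -
    interpret N: maximalideal N R using insert N by blast
    have re: "r \<otimes> e \<in> N" using N.I_l_closed e N r by blast
    have "z \<ominus> ?w = (z \<ominus> w) \<oplus> \<ominus> (r \<otimes> e)"
      using r e w z by (simp add: a_minus_def minus_add a_ac)
    from shift[OF N.is_ideal _ _ _ this] shift[OF N.is_ideal re _ _ refl, of w]
    show ?thesis using re w r e z N N.a_inv_closed by simp
  qed
  ultimately show ?case using w r e by (intro bexI[of _ ?w]) auto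
qed

text \<open>No maximal ideal contains both \<open>I\<close> and \<open>x\<close>, so together they
  generate the whole ring; the coefficient of \<open>x\<close> in a representation of
  \<open>\<one>\<close> is an inverse modulo \<open>I\<close>.\<close>

lemma (in noetherian_ring) Units_Quot_if_in_no_maximalideal:
  assumes "cring R" and I: "ideal I R" and x: "x \<in> carrier R"
    and nin: "\<And>M. \<lbrakk>maximalideal M R; I \<subseteq> M\<rbrakk> \<Longrightarrow> x \<notin> M"
  shows "I +> x \<in> Units (R Quot I)"
proof -
  interpret cring R by fact
  interpret I: ideal I R by fact
  have X: "ideal (PIdl x) R" using x by (rule cgenideal_ideal)
  have J: "ideal (I <+> PIdl x) R" by (intro add_ideals I X)
  have sub: "I \<subseteq> I <+> PIdl x" "PIdl x \<subseteq> I <+> PIdl x"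
    using genideal_self[of "I \<union> PIdl x"] I.a_subset ideal.Icarr[OF X]
    unfolding union_genideal[OF I X] by auto
  have "I <+> PIdl x = carrier R"
  proof (rule ccontr)
    assume "I <+> PIdl x \<noteq> carrier R"
    then obtain M where "maximalideal M R" "(I <+> PIdl x :: 'a set) \<subseteq> M"
      using exists_maximalideal[OF J] by blast
    with nin sub cgenideal_self[OF x] show False by blast
  qed
  then have "\<one> \<in> I <+> PIdl x" by simp
  then obtain k r where k: "k \<in> I" and r: "r \<in> carrier R" and one: "\<one> = k \<oplus> r \<otimes> x"
    by (auto simp: set_add_def' cgenideal_def)
  interpret Q: cring "R Quot I" by (rule I.quotient_is_cring[OF is_cring])
  note hom = I.rcos_ring_hom
  have "\<one> \<ominus> r \<otimes> x = k"
    unfolding one using I.Icarr[OF k] r x by (simp add: a_minus_def a_assoc r_neg)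
  then have "I +> \<one> = I +> (r \<otimes> x)"
    using quotient_eq_iff_same_a_r_cos[OF I one_closed, of "r \<otimes> x"] k r x by simp
  then have "(I +> r) \<otimes>\<^bsub>R Quot I\<^esub> (I +> x) = \<one>\<^bsub>R Quot I\<^esub>"
    using ring_hom_mult[OF hom r x] ring_hom_one[OF hom] by simp
  then show ?thesis
    using ring_hom_closed[OF hom r] ring_hom_closed[OF hom x] Q.m_comm
    unfolding Units_def by fastforce
qed

text \<open>An ideal containing \<open>I\<close> is a union of cosets of \<open>I\<close>, and a
  finite set of cosets has only finitely many subsets.\<close>

lemma (in ideal) finite_ideals_above:
  assumes "finite (carrier (R Quot I))"
  shows "finite {J. ideal J R \<and> I \<subseteq> J}"
proof (rule finite_subset)
  show "{J. ideal J R \<and> I \<subseteq> J} \<subseteq> Union ` Pow (carrier (R Quot I))"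
  proof
    fix J assume "J \<in> {J. ideal J R \<and> I \<subseteq> J}"
    then have J: "ideal J R" "I \<subseteq> J" by auto
    interpret J: ideal J R by (rule J)
    have "I +> x \<subseteq> J" if "x \<in> J" for x
      using that J(2) by (auto simp: a_r_coset_def' J.a_closed)
    moreover have "x \<in> I +> x" if "x \<in> J" for x using that J.Icarr a_rcos_self by blast
    ultimately have "J = \<Union> ((\<lambda>x. I +> x) ` J)" by blast
    moreover have "(\<lambda>x. I +> x) ` J \<subseteq> carrier (R Quot I)"
      using J.Icarr ring_hom_closed[OF rcos_ring_hom] by blast
    ultimately show "J \<in> Union ` Pow (carrier (R Quot I))" by blast
  qed
qed (use assms in simp)

lemma (in noetherian_ring) Quot_sum_of_two_Units:
  assumes "cring R" and I: "ideal I R" and fin: "finite (carrier (R Quot I))"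
    and card: "\<And>M. \<lbrakk>maximalideal M R; I \<subseteq> M\<rbrakk> \<Longrightarrow> card (carrier (R Quot M)) \<noteq> 2"
    and u: "u \<in> carrier (R Quot I)"
  shows "\<exists>v\<in>Units (R Quot I). \<exists>w\<in>Units (R Quot I). u = v \<oplus>\<^bsub>R Quot I\<^esub> w"
proof -
  interpret cring R by fact
  interpret I: ideal I R by fact
  note hom = I.rcos_ring_hom
  obtain z where z: "z \<in> carrier R" "u = I +> z" using u by (auto simp: FactRing_simps)
  let ?F = "{M. maximalideal M R \<and> I \<subseteq> M}"
  have "finite ?F"
    by (rule finite_subset[OF _ I.finite_ideals_above[OF fin]]) (auto intro: maximalideal.axioms(1))
  then obtain w where w: "w \<in> carrier R" "\<forall>M\<in>?F. w \<notin> M \<and> z \<ominus> w \<notin> M"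
    using obtain_common_two_nonmembers[of ?F z] card z by blast
  have "I +> w \<in> Units (R Quot I)" "I +> (z \<ominus> w) \<in> Units (R Quot I)"
    using w z by (auto intro!: Units_Quot_if_in_no_maximalideal[OF is_cring I])
  moreover have "(I +> w) \<oplus>\<^bsub>R Quot I\<^esub> (I +> (z \<ominus> w)) = I +> (w \<oplus> (z \<ominus> w))"
    using ring_hom_add[OF hom, of w "z \<ominus> w"] w z by simp
  moreover have "w \<oplus> (z \<ominus> w) = z" using w z by (simp add: a_minus_def a_lcomm[of w z] r_neg)
  ultimately show ?thesis using z by metis
qed

section \<open>Diameters of unitary Cayley graphs\<close>

lemma (in wf_digraph) awalk_cost_one: "awalk_cost (\<lambda>_. 1) p = length p"
  by (simp add: awalk_cost_def sum_list_triv)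

lemma wf_digraph_unitary_Cayley_graph: "wf_digraph (unitary_Cayley_graph R)"
  by unfold_locales (auto simp: unitary_Cayley_graph_def)

context cring
begin

interpretation G: wf_digraph "unitary_Cayley_graph R"
  by (rule wf_digraph_unitary_Cayley_graph)

abbreviation Cayley_dist :: "'a \<Rightarrow> 'a \<Rightarrow> ereal" where
  "Cayley_dist \<equiv> G.\<mu> (\<lambda>_. 1)"

lemma Cayley_dist_le_2:
  assumes "x \<in> carrier R" "y \<in> carrier R" "w \<in> carrier R"
    and "x \<ominus> w \<in> Units R" "w \<ominus> y \<in> Units R"
  shows "Cayley_dist x y \<le> 2"
proof -
  have "G.awalk x [(x, w), (w, y)] y"
    using assms by (simp add: G.awalk_simps) (simp add: unitary_Cayley_graph_def)
  from G.min_cost_le_walk_cost[OF this, of "\<lambda>_. 1"] show ?thesis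
    by (simp add: G.awalk_cost_one)
qed

lemma Cayley_dist_le_1:
  assumes "x \<in> carrier R" "y \<in> carrier R" "x = y \<or> x \<ominus> y \<in> Units R"
  shows "Cayley_dist x y \<le> 1"
proof -
  obtain p where "G.awalk x p y" "length p \<le> 1"
  proof (cases "x = y")
    case True
    then have "G.awalk x [] y"
      using assms by (simp add: G.awalk_simps) (simp add: unitary_Cayley_graph_def)
    with that show thesis by simp
  next
    case False
    then have "G.awalk x [(x, y)] y"
      using assms by (simp add: G.awalk_simps) (simp add: unitary_Cayley_graph_def)
    with that show thesis by simp
  qed
  then show ?thesis
    using order_trans[OF G.min_cost_le_walk_cost] by (simp add: G.awalk_cost_one)
qed

lemma Cayley_dist_ge_1:
  assumes "x \<noteq> y"
  shows "1 \<le> Cayley_dist x y"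
  unfolding G.\<mu>_def
proof (rule INF_greatest)
  fix p assume "p \<in> {p. G.awalk x p y}"
  then have "p \<noteq> []" using assms by (auto simp: G.awalk_simps)
  then show "1 \<le> ereal (G.awalk_cost (\<lambda>_. 1) p)"
    by (cases p) (auto simp: G.awalk_cost_one)
qed

text \<open>An empty walk would force \<open>x = y\<close>, and a single arc would make the
  difference a unit. If no walk exists, the infimum is infinite.\<close>

lemma Cayley_dist_ge_2:
  assumes "x \<noteq> y" and "x \<ominus> y \<notin> Units R"
  shows "2 \<le> Cayley_dist x y"
  unfolding G.\<mu>_def
proof (rule INF_greatest)
  fix p assume p: "p \<in> {p. G.awalk x p y}"
  have "2 \<le> length p"
  proof (rule ccontr)
    assume "\<not> 2 \<le> length p"
    then consider "p = []" | e where "p = [e]"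
      by (cases p; cases "tl p") auto
    then show False
      using p assms by cases (auto simp: G.awalk_simps, auto simp: unitary_Cayley_graph_def)
  qed
  then show "2 \<le> ereal (G.awalk_cost (\<lambda>_. 1) p)"
    by (simp add: G.awalk_cost_one)
qed

lemma graph_diameter_unitary_Cayley_graph_eqI:
  assumes "\<And>x y. \<lbrakk>x \<in> carrier R; y \<in> carrier R\<rbrakk> \<Longrightarrow> Cayley_dist x y \<le> d"
    and "x \<in> carrier R" "y \<in> carrier R" "d \<le> Cayley_dist x y"
  shows "graph_diameter (unitary_Cayley_graph R) = d"
  unfolding graph_diameter_def
proof (rule antisym)
  show "(SUP u\<in>verts (unitary_Cayley_graph R). SUP v\<in>verts (unitary_Cayley_graph R). Cayley_dist u v) \<le> d"
    using assms(1) by (intro SUP_least) (auto simp: unitary_Cayley_graph_def)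
  show "d \<le> (SUP u\<in>verts (unitary_Cayley_graph R). SUP v\<in>verts (unitary_Cayley_graph R). Cayley_dist u v)"
    using assms(2-4) by (intro SUP_upper2[of x] SUP_upper2[of y]) (auto simp: unitary_Cayley_graph_def)
qed

text \<open>If \<open>x - y = v + w\<close> with units \<open>v\<close> and \<open>w\<close>, then
  \<open>w + y\<close> is adjacent to both \<open>x\<close> and \<open>y\<close>. The lower bound
  comes from \<open>t\<close> and \<open>\<zero>\<close>, which are distinct and not
  adjacent.\<close>

lemma diameter_if_sum_of_two_Units:
  assumes sum: "\<And>u. u \<in> carrier R \<Longrightarrow> \<exists>v\<in>Units R. \<exists>w\<in>Units R. u = v \<oplus> w"
    and t: "t \<in> carrier R" "t \<noteq> \<zero>" "t \<notin> Units R"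
  shows "graph_diameter (unitary_Cayley_graph R) = 2"
proof (rule graph_diameter_unitary_Cayley_graph_eqI)
  fix x y assume xy: "x \<in> carrier R" "y \<in> carrier R"
  obtain v w where vw: "v \<in> Units R" "w \<in> Units R" "x \<ominus> y = v \<oplus> w"
    using sum[of "x \<ominus> y"] xy by auto
  then have vwR: "v \<in> carrier R" "w \<in> carrier R" by auto
  have "x = (x \<ominus> y) \<oplus> y" using xy by (simp add: a_minus_def a_assoc l_neg)
  then have "x = v \<oplus> (w \<oplus> y)" using vw(3) vwR xy by (simp add: a_assoc)
  then have "x \<ominus> (w \<oplus> y) = v" "(w \<oplus> y) \<ominus> y = w"
    using vwR xy by (simp_all add: a_minus_def a_assoc r_neg)
  with vw vwR xy show "Cayley_dist x y \<le> 2"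
    by (intro Cayley_dist_le_2[of x y "w \<oplus> y"]) auto
next
  show "2 \<le> Cayley_dist t \<zero>"
    using t by (intro Cayley_dist_ge_2) (auto simp: a_minus_def)
qed (use t in auto)

end

lemma (in field) diameter_unitary_Cayley_graph: "graph_diameter (unitary_Cayley_graph R) = 1"
proof (rule graph_diameter_unitary_Cayley_graph_eqI)
  show "Cayley_dist x y \<le> 1" if "x \<in> carrier R" "y \<in> carrier R" for x y
    using that by (intro Cayley_dist_le_1) (auto simp: field_Units)
  show "1 \<le> Cayley_dist \<one> \<zero>" by (intro Cayley_dist_ge_1) simp
qed auto

theorem theorem6p1:
  fixes R :: "('a, 'b) ring_scheme" (structure) and I :: "'a set"
  assumes "dedekind_domain R"
    and "ideal I R"
    and "I \<noteq> {\<zero>}"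
    and "finite (carrier (R Quot I))"
    and "carrier (R Quot I) \<noteq> {\<zero>\<^bsub>R Quot I\<^esub>}"
  shows "(primeideal I R \<longrightarrow> graph_diameter (unitary_Cayley_graph (R Quot I)) = 1) \<and>
    (\<not> primeideal I R \<and>
     \<not> (\<exists>P. primeideal P R \<and> P divides\<^bsub>ideals_set R\<^esub> I \<and> card (carrier (R Quot P)) = 2)
       \<longrightarrow> graph_diameter (unitary_Cayley_graph (R Quot I)) = 2)"
proof (intro conjI impI)
  interpret dedekind_domain R by fact
  interpret I: ideal I R by fact
  interpret Q: cring "R Quot I" by (rule I.quotient_is_cring[OF is_cring])
  show "graph_diameter (unitary_Cayley_graph (R Quot I)) = 1" if "primeideal I R"
    by (intro field.diameter_unitary_Cayley_graph maximalideal.quotient_is_field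
        nonzero_prime_maximal that assms(3) is_cring)
  assume *: "\<not> primeideal I R \<and>
    \<not> (\<exists>P. primeideal P R \<and> P divides\<^bsub>ideals_set R\<^esub> I \<and> card (carrier (R Quot P)) = 2)"
  have "\<not> field (R Quot I)"
    using * quot_domain_imp_primeideal[OF I.is_ideal] field.axioms(1) by blast
  \<comment> \<open>\<open>Q.cring_fieldI\<close> asks that the units be exactly the nonzero
    elements. As zero is not a unit, this can only fail through a nonzero nonunit
    \<open>t\<close>.\<close>
  moreover have "\<zero>\<^bsub>R Quot I\<^esub> \<notin> Units (R Quot I)"
    using assms(5) Q.one_zeroD Q.Units_r_inv[of "\<zero>\<^bsub>R Quot I\<^esub>"] Q.Units_inv_closed Q.l_null
    by metis
  ultimately obtain t where t: "t \<in> carrier (R Quot I)" "t \<noteq> \<zero>\<^bsub>R Quot I\<^esub>" "t \<notin> Units (R Quot I)"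
    using Q.cring_fieldI by blast
  have "card (carrier (R Quot M)) \<noteq> 2" if "maximalideal M R" "I \<subseteq> M" for M
    using * prime_divides_if_contains[OF assms(2,3)] maximalideal_prime that by blast
  then show "graph_diameter (unitary_Cayley_graph (R Quot I)) = 2"
    using Q.diameter_if_sum_of_two_Units[OF _ t] Quot_sum_of_two_Units[OF is_cring assms(2,4)] by blast
qed

end
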